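(* Let $R$ be a Lie conformal superalgebra, and let $f\in C^1(R,R)_{\bar0}$ be a Nijienhuis operator. Then a deformation of $R$ is obtained by putting $$\psi_{\lambda,-\partial-\lambda}(a,b):=(\hat{\mathbf{d}}f)_{\lambda,-\partial-\lambda}(a,b)=[a_\lambda b]_N,\qquad a,b\in R;$$ that is, $\psi=\hat{\mathbf{d}}f$ satisfies $\psi_{\lambda,-\partial-\lambda}(a,b)=[a_\lambda b]_N$ and generates a deformation of $R$. Furthermore, this deformation is trivial.
   Context: Everything is over $\mathbb{C}$. Degrees $|a|$ lie in $\mathbb{Z}_2$; whenever $|a|$ occurs, $a$ is homogeneous, and formulas are extended linearly. All $\mathbb{Z}_2$-graded $\mathbb{C}[\partial]$-modules are finitely generated. A Lie conformal superalgebra is a $\mathbb{Z}_2$-graded $\mathbb{C}[\partial]$-module $R=R_{\bar0}\oplus R_{\bar1}$ with a $\mathbb{C}$-bilinear map $R\times R\to R[\lambda]$, $(a,b)\mapsto[a_\lambda b]$, compatible with the grading, such that (C1) $[(\partial a)_\lambda b]=-\lambda[a_\lambda b]$; (C2) $[a_\lambda b]=-(-1)^{|a||b|}[b_{-\partial-\lambda}a]$; (C3) $[a_\lambda[b_\mu c]]=[[a_\lambda b]_{\lambda+\mu}c]+(-1)^{|a||b|}[b_\mu[a_\lambda c]]$. Brackets and maps are extended linearly over polynomials in the formal variables. Substituting an expression containing $-\partial$ for a formal variable (as in $[b_{-\partial-\lambda}a]$, $f_{-\partial}(b)$, $\psi_{\lambda,-\partial-\lambda}(a,b)$) means: write the object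 as a polynomial in that variable with coefficients in $R$ (and other variables), and replace the variable by the expression, with $\partial$ acting on the coefficients; e.g. if $f_\nu(b)=\sum_n\nu^nc_n$ then $f_{-\partial}(b)=\sum_n(-\partial)^nc_n$. $C^1(R,R)_{\bar0}$ is the space of even $\mathbb{C}$-linear maps $f_\lambda:R\to R[\lambda]$ with $f_\lambda(\partial a)=-\lambda f_\lambda(a)$. $C^2(R,R)_{\bar0}$ is the space of even $\mathbb{C}$-bilinear maps $(a,b)\mapsto\psi_{\lambda,\mu}(a,b)\in R[\lambda,\mu]$ with $\psi_{\lambda,\mu}(\partial a,b)=-\lambda\psi_{\lambda,\mu}(a,b)$, $\psi_{\lambda,\mu}(a,\partial b)=-\mu\psi_{\lambda,\mu}(a,b)$, $\psi_{\lambda,\mu}(a,b)=-(-1)^{|a||b|}\psi_{\mu,\lambda}(b,a)$. For $f\in C^1(R,R)_{\bar0}$, $\hat{\mathbf{d}}f\in C^2(R,R)_{\bar0}$ is $$(\hat{\mathbf{d}}f)_{\lambda,\mu}(a,b)=[a_\lambda(f_\mu(b))]-(-1)^{|a||b|}[b_\mu(f_\lambda(a))]-f_{\lambda+\mu}([a_\lambda b]).$$ For $\psi\in C^2(R,R)_{\bar0}$ consider the $t$-parameterized family of bilinear operations $[a_\lambda b]_t=[a_\lambda b]+t\,\psi_{\lambda,-\partial-\lambda}(a,b)$. One says that $\psi$ generates a deformation of $R$ if $[\cdot_\lambda\cdot]_t$ endows $R$ with a Lie conformal superalgebra structure (for all values of the parameter $t$). This deformation is trivial if there is $f\in C^1(R,R)_{\bar0}$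 such that, for ${T_t}_\lambda=\mathrm{id}+tf_\lambda$, $${T_t}_{-\partial}([a_\lambda b]_t)=[({T_t}_\lambda(a))_\lambda\,{T_t}_{-\partial}(b)]\qquad\text{for all }a,b\in R.$$ For $f\in C^1(R,R)_{\bar0}$ put $[a_\lambda b]_N=[(f_\lambda(a))_\lambda b]+[a_\lambda(f_{-\partial}(b))]-f_{-\partial}([a_\lambda b])$. The map $f$ is a Nijienhuis operator if $[(f_\lambda(a))_\lambda(f_\mu(b))]=f_{\lambda+\mu}([a_\lambda b]_N)$ for all $a,b\in R$. *)

theory Defs
  imports Complex_Main "HOL-Computational_Algebra.Polynomial" "HOL-Library.Z2"
begin

text \<open>
  A \<open>\<complex>[\<partial>]\<close>-module on the type \<open>'a\<close> is a module over \<open>complex poly\<close>, with scalar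
  multiplication \<open>s\<close>. Elements of \<open>R[\<lambda>]\<close> have type \<open>'a poly\<close>. Elements of \<open>R[\<lambda>,\<mu>]\<close> have
  type \<open>'a poly poly\<close>, where the outer variable is \<open>\<mu>\<close> and the inner variable is \<open>\<lambda>\<close>.
\<close>

definition cscale :: "(complex poly \<Rightarrow> 'a \<Rightarrow> 'a) \<Rightarrow> complex \<Rightarrow> 'a \<Rightarrow> 'a" where
  "cscale s c x = s [:c:] x"

definition D :: "(complex poly \<Rightarrow> 'a \<Rightarrow> 'a) \<Rightarrow> 'a \<Rightarrow> 'a" where
  "D s x = s [:0, 1:] x"

text \<open>
  If \<open>p = \<Sum>\<^sub>n \<nu>\<^sup>n c\<^sub>n\<close>, then \<open>psubst T g p = \<Sum>\<^sub>n T\<^sup>n (g c\<^sub>n)\<close>: the map \<open>g\<close> is extended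
  linearly over polynomials in \<open>\<nu>\<close>, and \<open>\<nu>\<close> is then replaced by the operator \<open>T\<close>.
\<close>

definition psubst ::
    "('m \<Rightarrow> 'm) \<Rightarrow> ('b::zero \<Rightarrow> 'm::comm_monoid_add) \<Rightarrow> 'b poly \<Rightarrow> 'm" where
  "psubst T g p = (\<Sum>n\<le>degree p. (T ^^ n) (g (coeff p n)))"

definition lam :: "'a::zero poly \<Rightarrow> 'a poly" where
  "lam p = pCons 0 p"

definition minus_D_lam ::
    "(complex poly \<Rightarrow> 'a::ab_group_add \<Rightarrow> 'a) \<Rightarrow> 'a poly \<Rightarrow> 'a poly" where
  "minus_D_lam s p = - map_poly (D s) p - lam p"

definition lam2 :: "'a::zero poly poly \<Rightarrow> 'a poly poly" where
  "lam2 p = map_poly lam p"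

definition mu2 :: "'a::zero poly poly \<Rightarrow> 'a poly poly" where
  "mu2 p = pCons 0 p"

definition lam_mu2 :: "'a::ab_group_add poly poly \<Rightarrow> 'a poly poly" where
  "lam_mu2 p = lam2 p + mu2 p"

text \<open>Rename the variable of an element of \<open>R[\<nu>]\<close> to \<open>\<lambda>\<close>, \<open>\<mu>\<close> or \<open>\<lambda> + \<mu>\<close> inside \<open>R[\<lambda>,\<mu>]\<close>.\<close>

definition at2 ::
    "('a::ab_group_add poly poly \<Rightarrow> 'a poly poly) \<Rightarrow> 'a poly \<Rightarrow> 'a poly poly" where
  "at2 T p = psubst T (\<lambda>x. [:[:x:]:]) p"

definition swap2 :: "'a::ab_group_add poly poly \<Rightarrow> 'a poly poly" where
  "swap2 p = psubst lam2 (at2 mu2) p"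

text \<open>The sign \<open>(-1)\<^bsup>ij\<^esup>\<close>, acting on \<open>x\<close>.\<close>

definition ksign :: "bit \<Rightarrow> bit \<Rightarrow> 'm::ab_group_add \<Rightarrow> 'm" where
  "ksign i j x = (if i * j = 1 then - x else x)"

locale graded_module = module s
  for s :: "complex poly \<Rightarrow> 'a::ab_group_add \<Rightarrow> 'a" +
  fixes V :: "bit \<Rightarrow> 'a set"
  assumes subspace_V: "\<And>i. subspace (V i)"
    and V_disjoint: "V 0 \<inter> V 1 = {0}"
    and V_sum: "\<And>a. \<exists>x\<in>V 0. \<exists>y\<in>V 1. a = x + y"
    and finitely_generated: "\<exists>S. finite S \<and> span S = UNIV"

locale lie_conformal_superalgebra = graded_module s V
  for s :: "complex poly \<Rightarrow> 'a::ab_group_add \<Rightarrow> 'a" and V :: "bit \<Rightarrow> 'a set" +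
  fixes br :: "'a \<Rightarrow> 'a \<Rightarrow> 'a poly"
  assumes linear_left: "\<And>b. Vector_Spaces.linear (cscale s) (\<lambda>c. map_poly (cscale s c)) (\<lambda>a. br a b)"
    and linear_right: "\<And>a. Vector_Spaces.linear (cscale s) (\<lambda>c. map_poly (cscale s c)) (br a)"
    and graded: "\<And>i j a b n. a \<in> V i \<Longrightarrow> b \<in> V j \<Longrightarrow> coeff (br a b) n \<in> V (i + j)"
    and sesquilinear: "\<And>a b. br (D s a) b = - lam (br a b)"
    and skew_symmetric: "\<And>i j a b. a \<in> V i \<Longrightarrow> b \<in> V j \<Longrightarrow>
      br a b = - ksign i j (psubst (minus_D_lam s) (\<lambda>x. [:x:]) (br b a))"
    and jacobi: "\<And>i j a b c. a \<in> V i \<Longrightarrow> b \<in> V j \<Longrightarrow>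
      psubst mu2 (\<lambda>x. at2 lam2 (br a x)) (br b c) =
        psubst lam2 (\<lambda>x. at2 lam_mu2 (br x c)) (br a b)
        + ksign i j (psubst lam2 (\<lambda>x. at2 mu2 (br b x)) (br a c))"

definition cochains1_even ::
    "(complex poly \<Rightarrow> 'a::ab_group_add \<Rightarrow> 'a) \<Rightarrow> (bit \<Rightarrow> 'a set) \<Rightarrow> ('a \<Rightarrow> 'a poly) set" where
  "cochains1_even s V = {f.
     Vector_Spaces.linear (cscale s) (\<lambda>c. map_poly (cscale s c)) f \<and>
     (\<forall>i a n. a \<in> V i \<longrightarrow> coeff (f a) n \<in> V i) \<and>
     (\<forall>a. f (D s a) = - lam (f a))}"

definition cochains2_even ::
    "(complex poly \<Rightarrow> 'a::ab_group_add \<Rightarrow> 'a) \<Rightarrow> (bit \<Rightarrow> 'a set) \<Rightarrow>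
     ('a \<Rightarrow> 'a \<Rightarrow> 'a poly poly) set" where
  "cochains2_even s V = {\<psi>.
     (\<forall>b. Vector_Spaces.linear (cscale s) (\<lambda>c. map_poly (map_poly (cscale s c))) (\<lambda>a. \<psi> a b)) \<and>
     (\<forall>a. Vector_Spaces.linear (cscale s) (\<lambda>c. map_poly (map_poly (cscale s c))) (\<psi> a)) \<and>
     (\<forall>i j a b m n. a \<in> V i \<longrightarrow> b \<in> V j \<longrightarrow> coeff (coeff (\<psi> a b) m) n \<in> V (i + j)) \<and>
     (\<forall>a b. \<psi> (D s a) b = - lam2 (\<psi> a b)) \<and>
     (\<forall>a b. \<psi> a (D s b) = - mu2 (\<psi> a b)) \<and>
     (\<forall>i j a b. a \<in> V i \<longrightarrow> b \<in> V j \<longrightarrow> \<psi> a b = - ksign i j (swap2 (\<psi> b a)))}"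

definition hcomp :: "(bit \<Rightarrow> 'a::ab_group_add set) \<Rightarrow> bit \<Rightarrow> 'a \<Rightarrow> 'a" where
  "hcomp V i a = (THE x. x \<in> V i \<and> a - x \<in> V (i + 1))"

definition dhat_homogeneous ::
    "('a::ab_group_add \<Rightarrow> 'a \<Rightarrow> 'a poly) \<Rightarrow> ('a \<Rightarrow> 'a poly) \<Rightarrow> bit \<Rightarrow> bit \<Rightarrow> 'a \<Rightarrow> 'a \<Rightarrow> 'a poly poly"
  where
  "dhat_homogeneous br f i j a b =
     psubst mu2 (\<lambda>y. at2 lam2 (br a y)) (f b)
     - ksign i j (psubst lam2 (\<lambda>x. at2 mu2 (br b x)) (f a))
     - psubst lam2 (\<lambda>z. at2 lam_mu2 (f z)) (br a b)"

definition dhat ::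
    "(bit \<Rightarrow> 'a::ab_group_add set) \<Rightarrow> ('a \<Rightarrow> 'a \<Rightarrow> 'a poly) \<Rightarrow> ('a \<Rightarrow> 'a poly) \<Rightarrow>
     'a \<Rightarrow> 'a \<Rightarrow> 'a poly poly" where
  "dhat V br f a b =
     (\<Sum>i\<in>{0, 1}. \<Sum>j\<in>{0, 1}. dhat_homogeneous br f i j (hcomp V i a) (hcomp V j b))"

text \<open>\<open>\<psi>\<^bsub>\<lambda>,-\<partial>-\<lambda>\<^esub>(a, b)\<close>\<close>

definition at_minus_D_lam ::
    "(complex poly \<Rightarrow> 'a::ab_group_add \<Rightarrow> 'a) \<Rightarrow> ('a \<Rightarrow> 'a \<Rightarrow> 'a poly poly) \<Rightarrow> 'a \<Rightarrow> 'a \<Rightarrow> 'a poly"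
  where
  "at_minus_D_lam s \<psi> a b = psubst (minus_D_lam s) (\<lambda>p. p) (\<psi> a b)"

text \<open>\<open>f\<^bsub>-\<partial>\<^esub>(b)\<close>\<close>

definition at_minus_D ::
    "(complex poly \<Rightarrow> 'a::ab_group_add \<Rightarrow> 'a) \<Rightarrow> ('a \<Rightarrow> 'a poly) \<Rightarrow> 'a \<Rightarrow> 'a" where
  "at_minus_D s f b = psubst (\<lambda>x. - D s x) (\<lambda>x. x) (f b)"

definition deformed_bracket ::
    "(complex poly \<Rightarrow> 'a::ab_group_add \<Rightarrow> 'a) \<Rightarrow> ('a \<Rightarrow> 'a \<Rightarrow> 'a poly) \<Rightarrow>
     ('a \<Rightarrow> 'a \<Rightarrow> 'a poly poly) \<Rightarrow> complex \<Rightarrow> 'a \<Rightarrow> 'a \<Rightarrow> 'a poly" where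
  "deformed_bracket s br \<psi> t a b = br a b + map_poly (cscale s t) (at_minus_D_lam s \<psi> a b)"

definition generates_deformation ::
    "(complex poly \<Rightarrow> 'a::ab_group_add \<Rightarrow> 'a) \<Rightarrow> (bit \<Rightarrow> 'a set) \<Rightarrow> ('a \<Rightarrow> 'a \<Rightarrow> 'a poly) \<Rightarrow>
     ('a \<Rightarrow> 'a \<Rightarrow> 'a poly poly) \<Rightarrow> bool" where
  "generates_deformation s V br \<psi> \<longleftrightarrow>
     (\<forall>t. lie_conformal_superalgebra s V (deformed_bracket s br \<psi> t))"

definition T_map ::
    "(complex poly \<Rightarrow> 'a::ab_group_add \<Rightarrow> 'a) \<Rightarrow> ('a \<Rightarrow> 'a poly) \<Rightarrow> complex \<Rightarrow> 'a \<Rightarrow> 'a poly" where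
  "T_map s f t a = [:a:] + map_poly (cscale s t) (f a)"

definition trivial_deformation ::
    "(complex poly \<Rightarrow> 'a::ab_group_add \<Rightarrow> 'a) \<Rightarrow> (bit \<Rightarrow> 'a set) \<Rightarrow> ('a \<Rightarrow> 'a \<Rightarrow> 'a poly) \<Rightarrow>
     ('a \<Rightarrow> 'a \<Rightarrow> 'a poly poly) \<Rightarrow> bool" where
  "trivial_deformation s V br \<psi> \<longleftrightarrow>
     (\<exists>f\<in>cochains1_even s V. \<forall>t a b.
        map_poly (at_minus_D s (T_map s f t)) (deformed_bracket s br \<psi> t a b) =
        psubst lam (\<lambda>x. br x (at_minus_D s (T_map s f t) b)) (T_map s f t a))"

definition bracket_N ::
    "(complex poly \<Rightarrow> 'a::ab_group_add \<Rightarrow> 'a) \<Rightarrow> ('a \<Rightarrow> 'a \<Rightarrow> 'a poly) \<Rightarrow> ('a \<Rightarrow> 'a poly) \<Rightarrow>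
     'a \<Rightarrow> 'a \<Rightarrow> 'a poly" where
  "bracket_N s br f a b =
     psubst lam (\<lambda>x. br x b) (f a) + br a (at_minus_D s f b) - map_poly (at_minus_D s f) (br a b)"

definition nijenhuis_operator ::
    "(complex poly \<Rightarrow> 'a::ab_group_add \<Rightarrow> 'a) \<Rightarrow> ('a \<Rightarrow> 'a \<Rightarrow> 'a poly) \<Rightarrow> ('a \<Rightarrow> 'a poly) \<Rightarrow> bool" where
  "nijenhuis_operator s br f \<longleftrightarrow>
     (\<forall>a b. psubst mu2 (\<lambda>y. psubst lam2 (\<lambda>x. at2 lam2 (br x y)) (f a)) (f b) =
            psubst lam2 (\<lambda>z. at2 lam_mu2 (f z)) (bracket_N s br f a b))"

end

theory Submission
  imports Defs
begin

text \<open>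
  Put \<open>F = f\<^bsub>-\<partial>\<^esub>\<close>. It is \<open>\<complex>[\<partial>]\<close>-linear, and conformal sesquilinearity turns \<open>[(f\<^bsub>\<lambda>\<^esub> a)\<^bsub>\<lambda>\<^esub> b]\<close> into
  \<open>[(F a)\<^bsub>\<lambda>\<^esub> b]\<close>. So \<open>[a\<^bsub>\<lambda>\<^esub> b]\<^bsub>N\<^esub> = [(F a)\<^bsub>\<lambda>\<^esub> b] + [a\<^bsub>\<lambda>\<^esub> (F b)] - F [a\<^bsub>\<lambda>\<^esub> b]\<close>, and the substitution
  \<open>\<mu> = -\<partial> - \<lambda>\<close> turns the Nijenhuis condition into \<open>[(F a)\<^bsub>\<lambda>\<^esub> (F b)] = F [a\<^bsub>\<lambda>\<^esub> b]\<^bsub>N\<^esub>\<close>. Hence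
  \<open>T = 1 + t F\<close> satisfies \<open>T [a\<^bsub>\<lambda>\<^esub> b]\<^bsub>t\<^esub> = [(T a)\<^bsub>\<lambda>\<^esub> (T b)]\<close>, which is triviality. The map \<open>T\<close> need not be
  injective, but the Jacobiator of \<open>[\<cdot>\<^bsub>\<lambda>\<^esub> \<cdot>]\<^bsub>t\<^esub>\<close> has the form \<open>t A + t\<^sup>2 B\<close> and is killed by \<open>1 + t F\<close>
  for every \<open>t\<close>; comparing coefficients of powers of \<open>t\<close> gives \<open>A = 0\<close> and \<open>B = 0\<close>.
\<close>

section \<open>Substitution into polynomials\<close>

text \<open>Terms beyond the degree have the form T^n (g 0) = 0, so every larger summation bound
  gives the same value. The slack is needed for \<open>pCons a 0\<close>, whose degree is 0 rather
  than 1.\<close>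

lemma psubst_eq_sum:
  assumes "additive T" "additive g" "degree p \<le> N"
  shows "psubst T g p = (\<Sum>n\<le>N. (T ^^ n) (g (coeff p n)))"
proof -
  have "(T ^^ n) 0 = 0" for n
    by (induction n) (simp_all add: additive.zero[OF assms(1)])
  then show ?thesis
    unfolding psubst_def using assms(3)
    by (intro sum.mono_neutral_left) (auto simp: additive.zero[OF assms(2)] not_le coeff_eq_0)
qed

lemma psubst_0: "additive g \<Longrightarrow> psubst T g 0 = 0"
  by (simp add: psubst_def additive.zero)

text \<open>Horner's rule. It lets later facts about \<open>psubst\<close> go by
  \<open>pCons\<close> induction rather than by manipulating sums.\<close>

lemma psubst_pCons:
  assumes "additive T" "additive g"
  shows "psubst T g (pCons a p) = g a + T (psubst T g p)"
proof -
  have "psubst T g (pCons a p) = (\<Sum>n\<le>Suc (degree p). (T ^^ n) (g (coeff (pCons a p) n)))"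
    by (rule psubst_eq_sum[OF assms]) (rule degree_pCons_le)
  also have "\<dots> = g a + (\<Sum>n\<le>degree p. T ((T ^^ n) (g (coeff p n))))"
    by (subst sum.atMost_Suc_shift) simp
  also have "\<dots> = g a + T (psubst T g p)"
    by (simp add: psubst_def additive.sum[OF assms(1)])
  finally show ?thesis .
qed

lemma psubst_const:
  assumes "additive T" "additive g"
  shows "psubst T g [:a:] = g a"
  by (simp add: psubst_pCons psubst_0 assms additive.zero[OF assms(1)] additive.zero[OF assms(2)])

lemma psubst_lam:
  assumes "additive T" "additive g"
  shows "psubst T g (lam p) = T (psubst T g p)"
  by (simp add: lam_def psubst_pCons assms additive.zero[OF assms(1)] additive.zero[OF assms(2)])

lemma psubst_mu2:
  assumes "additive T" "additive g"
  shows "psubst T g (mu2 p) = T (psubst T g p)"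
  by (simp add: mu2_def psubst_pCons assms additive.zero[OF assms(1)] additive.zero[OF assms(2)])

named_theorems additive_intros

lemma additive_psubst [additive_intros]:
  assumes "additive T" "additive g" "additive h"
  shows "additive (\<lambda>x. psubst T g (h x))"
proof
  have "psubst T g (p + q) = psubst T g p + psubst T g q" for p q
    by (induction p q rule: poly_induct2)
      (simp_all add: psubst_0 psubst_pCons assms additive.add[OF assms(1)]
        additive.add[OF assms(2)])
  then show "psubst T g (h (x + y)) = psubst T g (h x) + psubst T g (h y)" for x y
    by (simp add: additive.add[OF assms(3)])
qed

text \<open>Substitutions are compared by comparing the images of the constants and of the variable.\<close>

lemma psubst_hom:
  assumes "additive T" "additive g" "additive T'" "additive g'" "additive H"
    and "\<And>x. H (T x) = T' (H x)" "\<And>x. H (g x) = g' x"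
  shows "H (psubst T g p) = psubst T' g' p"
  by (induction p)
    (simp_all add: psubst_0 psubst_pCons assms(1-4,6,7) additive.add[OF assms(5)]
      additive.zero[OF assms(5)])

text \<open>Agreement is asked only on the coefficients of p, so that for p = \<open>f a\<close>
  with homogeneous a, axioms restricted to homogeneous elements can be used.\<close>

lemma psubst_cong:
  "(\<And>n. g (coeff p n) = h (coeff p n)) \<Longrightarrow> psubst T g p = psubst T h p"
  by (simp add: psubst_def)

lemma psubst_map_poly:
  assumes "additive T" "additive g" "additive h"
  shows "psubst T g (map_poly h p) = psubst T (\<lambda>x. g (h x)) p"
proof -
  have "additive (\<lambda>x. g (h x))"
    by unfold_locales (simp add: additive.add[OF assms(2)] additive.add[OF assms(3)])
  then show ?thesis
    by (induction p)
      (simp_all add: psubst_0 psubst_pCons map_poly_pCons assms additive.zero[OF assms(3)])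
qed

lemma psubst_add_fun:
  assumes "additive T" "additive g" "additive h"
  shows "psubst T (\<lambda>x. g x + h x) p = psubst T g p + psubst T h p"
proof -
  have "additive (\<lambda>x. g x + h x)"
    by unfold_locales (simp add: additive.add[OF assms(2)] additive.add[OF assms(3)])
  then show ?thesis
    by (induction p) (simp_all add: psubst_0 psubst_pCons assms additive.add[OF assms(1)])
qed

lemma psubst_lam_const: "psubst lam (\<lambda>x. [:x:]) p = p"
  for p :: "'a::ab_group_add poly"
proof -
  have "additive (lam :: 'a poly \<Rightarrow> 'a poly)" "additive (\<lambda>x :: 'a. [:x:])"
    by unfold_locales (simp_all add: lam_def)
  then show ?thesis
    by (induction p) (simp_all add: psubst_0 psubst_pCons, simp add: lam_def)
qed

lemma psubst_closed:
  assumes "\<And>n. g (coeff p n) \<in> W" "\<And>x. x \<in> W \<Longrightarrow> T x \<in> W"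
    and "0 \<in> W" "\<And>x y. x \<in> W \<Longrightarrow> y \<in> W \<Longrightarrow> x + y \<in> W"
  shows "psubst T g p \<in> W"
proof -
  have pow: "(T ^^ n) x \<in> W" if "x \<in> W" for n x
    using that by (induction n) (auto intro: assms)
  have "(\<Sum>n\<le>N. (T ^^ n) (g (coeff p n))) \<in> W" for N
    by (induction N) (simp_all add: assms(1,2,4) pow)
  then show ?thesis
    by (simp add: psubst_def)
qed

section \<open>Additivity of the basic operators, and the sign rule\<close>

lemma additive_id [additive_intros]: "additive (\<lambda>x. x)"
  by unfold_locales simp

lemma additive_const_poly [additive_intros]:
  assumes "additive h"
  shows "additive (\<lambda>x. [:h x:])"
  by unfold_locales (simp add: additive.add[OF assms])

lemma additive_uminus [additive_intros]:
  assumes "additive h"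
  shows "additive (\<lambda>x. - h x)"
  by unfold_locales (simp add: additive.add[OF assms])

lemma additive_plus [additive_intros]:
  assumes "additive g" "additive h"
  shows "additive (\<lambda>x. g x + h x)"
  by unfold_locales (simp add: additive.add[OF assms(1)] additive.add[OF assms(2)])

lemma additive_minus [additive_intros]:
  assumes "additive g" "additive h"
  shows "additive (\<lambda>x. g x - h x)"
  by unfold_locales (simp add: additive.add[OF assms(1)] additive.add[OF assms(2)])

lemma additive_map_poly [additive_intros]:
  assumes "additive g" "additive h"
  shows "additive (\<lambda>x. map_poly g (h x))"
  by unfold_locales
    (simp add: poly_eq_iff coeff_map_poly additive.add[OF assms(1)] additive.add[OF assms(2)]
      additive.zero[OF assms(1)])

lemma additive_lam [additive_intros]: "additive lam"
  by unfold_locales (simp add: lam_def)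

lemma additive_lam2 [additive_intros]: "additive lam2"
  unfolding lam2_def by (intro additive_intros)

lemma additive_mu2 [additive_intros]: "additive mu2"
  by unfold_locales (simp add: mu2_def)

lemma additive_lam_mu2 [additive_intros]: "additive lam_mu2"
  unfolding lam_mu2_def by (intro additive_intros)

lemma additive_at2 [additive_intros]:
  assumes "additive T" "additive h"
  shows "additive (\<lambda>x. at2 T (h x))"
  unfolding at2_def by (intro additive_intros assms)

lemma additive_swap2 [additive_intros]: "additive swap2"
  unfolding swap2_def by (intro additive_intros)

lemma additive_ksign [additive_intros]:
  assumes "additive h"
  shows "additive (\<lambda>x. ksign i j (h x))"
  by unfold_locales (simp add: ksign_def additive.add[OF assms])

lemma ksign_hom: "additive H \<Longrightarrow> H (ksign i j x) = ksign i j (H x)"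
  by (simp add: ksign_def additive.minus)

lemma ksign_commute: "ksign i j = ksign j i"
  by (simp add: ksign_def fun_eq_iff mult.commute)

lemma ksign_ksign [simp]: "ksign i j (ksign i j x) = x"
  by (simp add: ksign_def)

section \<open>Commutation and exchange of the variables \<lambda> and \<mu>\<close>

lemma lam2_mu2: "lam2 (mu2 p) = mu2 (lam2 p)"
  by (simp add: lam2_def mu2_def map_poly_pCons lam_def)

lemma hom_at2:
  assumes "additive T" "additive T'" "additive H" "\<And>x. H (T x) = T' (H x)"
  shows "H (at2 T p) = psubst T' (\<lambda>x. H [:[:x:]:]) p"
proof -
  have "additive (\<lambda>x. H [:[:x:]:])"
    by unfold_locales (simp flip: additive.add[OF assms(3)])
  then show ?thesis
    unfolding at2_def using assms by (intro psubst_hom additive_intros) auto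
qed

lemma at2_lam: "additive T \<Longrightarrow> at2 T (lam p) = T (at2 T p)"
  unfolding at2_def by (intro psubst_lam additive_intros)

lemma swap2_mu2: "swap2 (mu2 p) = lam2 (swap2 p)"
  unfolding swap2_def by (intro psubst_mu2 additive_intros)

lemma swap2_lam2: "swap2 (lam2 p) = mu2 (swap2 p)"
proof -
  have "swap2 (lam2 p) = psubst lam2 (\<lambda>x. at2 mu2 (lam x)) p"
    unfolding swap2_def lam2_def[of p] by (intro psubst_map_poly additive_intros)
  also have "\<dots> = mu2 (swap2 p)"
    unfolding swap2_def
    by (rule psubst_hom[symmetric, where H = mu2])
      (intro additive_intros | simp add: at2_lam lam2_mu2 additive_mu2)+
  finally show ?thesis .
qed

lemma swap2_const: "swap2 [:[:x:]:] = [:[:x:]:]"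
  unfolding swap2_def at2_def by (subst psubst_const, (intro additive_intros)+)+ simp

lemma swap2_lam_mu2: "swap2 (lam_mu2 p) = lam_mu2 (swap2 p)"
  by (simp add: lam_mu2_def additive.add[OF additive_swap2] swap2_lam2 swap2_mu2 add.commute)

lemma swap2_at2:
  "swap2 (at2 lam2 p) = at2 mu2 p"
  "swap2 (at2 mu2 p) = at2 lam2 p"
  "swap2 (at2 lam_mu2 p) = at2 lam_mu2 p"
  by (simp_all add: hom_at2[OF additive_lam2 additive_mu2 additive_swap2 swap2_lam2]
    hom_at2[OF additive_mu2 additive_lam2 additive_swap2 swap2_mu2]
    hom_at2[OF additive_lam_mu2 additive_lam_mu2 additive_swap2 swap2_lam_mu2]
    swap2_const, simp_all add: at2_def)

text \<open>Here the polynomial is fixed and the coefficient map varies. This is what makes a term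
  such as \<open>psubst mu2 (\<lambda>y. at2 lam2 (br a y)) p\<close> additive in a.\<close>

lemma additive_psubst_fun [additive_intros]:
  assumes "additive T" "\<And>a. additive (G a)" "\<And>y. additive (\<lambda>a. G a y)"
  shows "additive (\<lambda>a. psubst T (G a) p)"
proof
  fix a b
  have "G (a + b) = (\<lambda>y. G a y + G b y)"
    by (rule ext) (rule additive.add[OF assms(3)])
  then show "psubst T (G (a + b)) p = psubst T (G a) p + psubst T (G b) p"
    by (simp add: psubst_add_fun assms(1,2))
qed

section \<open>Maps acting on the coefficients of polynomials in \<lambda> and \<mu>\<close>

abbreviation map_poly2 :: "('a::zero \<Rightarrow> 'b::zero) \<Rightarrow> 'a poly poly \<Rightarrow> 'b poly poly" where
  "map_poly2 h \<equiv> map_poly (map_poly h)"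

lemma map_poly_lam: "additive h \<Longrightarrow> map_poly h (lam p) = lam (map_poly h p)"
  by (simp add: lam_def map_poly_pCons additive.zero)

lemma map_poly2_mu2: "map_poly2 h (mu2 p) = mu2 (map_poly2 h p)"
  by (simp add: mu2_def map_poly_pCons)

lemma map_poly2_lam2: "additive h \<Longrightarrow> map_poly2 h (lam2 p) = lam2 (map_poly2 h p)"
  by (simp add: poly_eq_iff lam2_def coeff_map_poly lam_def coeff_pCons additive.zero
    split: nat.splits)

lemma map_poly2_lam_mu2:
  assumes "additive h"
  shows "map_poly2 h (lam_mu2 p) = lam_mu2 (map_poly2 h p)"
proof -
  have "additive (map_poly2 h)"
    by (intro additive_intros assms)
  then show ?thesis
    by (simp add: lam_mu2_def additive.add map_poly2_mu2 map_poly2_lam2[OF assms])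
qed

lemma at2_map_poly:
  assumes "additive h" "additive T" "additive T'" "\<And>p. map_poly2 h (T p) = T' (map_poly2 h p)"
  shows "at2 T' (map_poly h p) = map_poly2 h (at2 T p)"
proof -
  have "at2 T' (map_poly h p) = psubst T' (\<lambda>x. [:[:h x:]:]) p"
    unfolding at2_def by (intro psubst_map_poly additive_intros assms)
  also have "\<dots> = psubst T' (\<lambda>x. map_poly2 h [:[:x:]:]) p"
    by (simp add: map_poly_pCons additive.zero[OF assms(1)])
  also have "\<dots> = map_poly2 h (at2 T p)"
    by (intro hom_at2[symmetric] additive_intros assms)
  finally show ?thesis .
qed

lemma at2_lam_map_poly:
  assumes "additive h"
  shows "at2 lam2 (map_poly h p) = map_poly2 h (at2 lam2 p)"
    and "at2 mu2 (map_poly h p) = map_poly2 h (at2 mu2 p)"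
    and "at2 lam_mu2 (map_poly h p) = map_poly2 h (at2 lam_mu2 p)"
  by (rule at2_map_poly[OF assms additive_lam2 additive_lam2 map_poly2_lam2[OF assms]]
    at2_map_poly[OF assms additive_mu2 additive_mu2 map_poly2_mu2]
    at2_map_poly[OF assms additive_lam_mu2 additive_lam_mu2 map_poly2_lam_mu2[OF assms]])+

lemma map_poly2_psubst:
  assumes "additive h" "additive g"
  shows "map_poly2 h (psubst lam2 g p) = psubst lam2 (\<lambda>x. map_poly2 h (g x)) p"
    and "map_poly2 h (psubst mu2 g p) = psubst mu2 (\<lambda>x. map_poly2 h (g x)) p"
  by (intro psubst_hom additive_intros assms map_poly2_lam2 map_poly2_mu2 refl)+

section \<open>The Jacobi identity for bilinear maps\<close>

text \<open>Additivity is all that substitution requires; compatibility with scalars is supplied as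
  a separate hypothesis in \<open>jac_scale_right\<close>.\<close>

definition biadditive :: "('a::ab_group_add \<Rightarrow> 'a \<Rightarrow> 'a poly) \<Rightarrow> bool" where
  "biadditive P \<longleftrightarrow> (\<forall>a. additive (P a)) \<and> (\<forall>b. additive (\<lambda>a. P a b))"

lemma biadditive_left:
  assumes "biadditive P" "additive h"
  shows "additive (\<lambda>x. P (h x) b)"
proof -
  interpret additive "\<lambda>a. P a b" using assms(1) by (simp add: biadditive_def)
  show ?thesis by unfold_locales (simp add: additive.add[OF assms(2)] add)
qed

lemma biadditive_right:
  assumes "biadditive P" "additive h"
  shows "additive (\<lambda>x. P a (h x))"
proof -
  interpret additive "P a" using assms(1) by (simp add: biadditive_def)
  show ?thesis by unfold_locales (simp add: additive.add[OF assms(2)] add)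
qed

text \<open>The Jacobiator, polarized: P is the outer bracket and Q the inner one, and i, j stand
  for the parities of a and b. Keeping P and Q apart allows the Jacobiator of a sum of brackets to
  be expanded.\<close>

definition jac ::
    "('a::ab_group_add \<Rightarrow> 'a \<Rightarrow> 'a poly) \<Rightarrow> ('a \<Rightarrow> 'a \<Rightarrow> 'a poly) \<Rightarrow> bit \<Rightarrow> bit \<Rightarrow> 'a \<Rightarrow> 'a \<Rightarrow> 'a \<Rightarrow>
      'a poly poly" where
  "jac P Q i j a b c =
     psubst mu2 (\<lambda>x. at2 lam2 (P a x)) (Q b c)
     - psubst lam2 (\<lambda>x. at2 lam_mu2 (P x c)) (Q a b)
     - ksign i j (psubst lam2 (\<lambda>x. at2 mu2 (P b x)) (Q a c))"

lemma jac_add_left: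
  assumes "biadditive P" "biadditive P'"
  shows "jac (\<lambda>a b. P a b + P' a b) Q i j a b c = jac P Q i j a b c + jac P' Q i j a b c"
proof -
  have "at2 T (p + q) = at2 T p + at2 T q" if "additive T" for T and p q :: "'a poly"
    using additive.add[OF additive_at2[OF that additive_id]] .
  note at2_add = this[OF additive_lam2] this[OF additive_mu2] this[OF additive_lam_mu2]
  have "psubst mu2 (\<lambda>x. at2 lam2 (P a x + P' a x)) (Q b c) =
      psubst mu2 (\<lambda>x. at2 lam2 (P a x)) (Q b c) + psubst mu2 (\<lambda>x. at2 lam2 (P' a x)) (Q b c)"
    unfolding at2_add by (intro psubst_add_fun additive_intros assms[THEN biadditive_left]
        assms[THEN biadditive_right])
  moreover have "psubst lam2 (\<lambda>x. at2 lam_mu2 (P x c + P' x c)) (Q a b) =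
      psubst lam2 (\<lambda>x. at2 lam_mu2 (P x c)) (Q a b)
      + psubst lam2 (\<lambda>x. at2 lam_mu2 (P' x c)) (Q a b)"
    unfolding at2_add by (intro psubst_add_fun additive_intros assms[THEN biadditive_left]
        assms[THEN biadditive_right])
  moreover have "psubst lam2 (\<lambda>x. at2 mu2 (P b x + P' b x)) (Q a c) =
      psubst lam2 (\<lambda>x. at2 mu2 (P b x)) (Q a c) + psubst lam2 (\<lambda>x. at2 mu2 (P' b x)) (Q a c)"
    unfolding at2_add by (intro psubst_add_fun additive_intros assms[THEN biadditive_left]
        assms[THEN biadditive_right])
  ultimately show ?thesis
    by (simp add: jac_def ksign_def)
qed

lemma jac_add_right:
  assumes "biadditive P"
  shows "jac P (\<lambda>a b. Q a b + Q' a b) i j a b c = jac P Q i j a b c + jac P Q' i j a b c"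
proof -
  have "additive (psubst mu2 (\<lambda>x. at2 lam2 (P a x)))"
    "additive (psubst lam2 (\<lambda>x. at2 lam_mu2 (P x c)))"
    "additive (psubst lam2 (\<lambda>x. at2 mu2 (P b x)))"
    by (intro additive_intros biadditive_left[OF assms] biadditive_right[OF assms])+
  note * = this[THEN additive.add]
  show ?thesis
    by (simp add: jac_def ksign_def *)
qed

text \<open>A map on coefficients commutes with multiplication by \<lambda> and \<mu>, so it passes
  through the substitutions and reaches the outer bracket only.\<close>

lemma map_poly2_jac:
  assumes "biadditive P" "additive h"
  shows "map_poly2 h (jac P Q i j a b c) = jac (\<lambda>a b. map_poly h (P a b)) Q i j a b c"
proof -
  have add: "additive (map_poly2 h)"
    by (intro additive_intros assms)
  have "additive (\<lambda>x. at2 lam2 (P a x))" "additive (\<lambda>x. at2 lam_mu2 (P x c))"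
    "additive (\<lambda>x. at2 mu2 (P b x))"
    by (intro additive_intros biadditive_left[OF assms(1)] biadditive_right[OF assms(1)])+
  note * = this[THEN map_poly2_psubst(1)[OF assms(2)]] this[THEN map_poly2_psubst(2)[OF assms(2)]]
  show ?thesis
    by (simp add: jac_def additive.diff[OF add] ksign_hom[OF add] * at2_lam_map_poly[OF assms(2)])
qed

lemma jac_map_poly_right:
  assumes "biadditive P" "additive h"
  shows "jac P (\<lambda>a b. map_poly h (Q a b)) i j a b c =
    psubst mu2 (\<lambda>x. at2 lam2 (P a (h x))) (Q b c)
     - psubst lam2 (\<lambda>x. at2 lam_mu2 (P (h x) c)) (Q a b)
     - ksign i j (psubst lam2 (\<lambda>x. at2 mu2 (P b (h x))) (Q a c))"
proof -
  have "additive (\<lambda>x. at2 lam2 (P a x))" "additive (\<lambda>x. at2 lam_mu2 (P x c))"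
    "additive (\<lambda>x. at2 mu2 (P b x))"
    by (intro additive_intros biadditive_left[OF assms(1)] biadditive_right[OF assms(1)])+
  then show ?thesis
    by (simp add: jac_def psubst_map_poly[OF additive_lam2 _ assms(2)]
      psubst_map_poly[OF additive_mu2 _ assms(2)])
qed

lemma jac_scale_right:
  assumes "biadditive P" "additive h"
    and "\<And>a b. P (h a) b = map_poly h (P a b)" "\<And>a b. P a (h b) = map_poly h (P a b)"
  shows "jac P (\<lambda>a b. map_poly h (Q a b)) i j a b c = map_poly2 h (jac P Q i j a b c)"
  unfolding jac_map_poly_right[OF assms(1,2)] map_poly2_jac[OF assms(1,2)]
  by (simp add: assms(3,4) jac_def)

text \<open>First h enters the outer bracket, giving \<open>Q (h a) (h x)\<close> for each
  coefficient x of the inner one. Collecting the values h x gives \<open>map_poly h\<close> of the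
  inner bracket, which is Q at the images. Injectivity of h is not at stake.\<close>

lemma map_poly2_jac_hom:
  fixes h :: "'a::ab_group_add \<Rightarrow> 'a"
  assumes "biadditive P" "biadditive Q" "additive h"
    and "\<And>a b. map_poly h (P a b) = Q (h a) (h b)"
  shows "map_poly2 h (jac P P i j a b c) = jac Q Q i j (h a) (h b) (h c)"
proof -
  have "map_poly2 h (jac P P i j a b c) = jac (\<lambda>a b. Q (h a) (h b)) P i j a b c"
    by (simp add: map_poly2_jac assms)
  also have "\<dots> = psubst mu2 (\<lambda>x. at2 lam2 (Q (h a) (h x))) (P b c)
     - psubst lam2 (\<lambda>x. at2 lam_mu2 (Q (h x) (h c))) (P a b)
     - ksign i j (psubst lam2 (\<lambda>x. at2 mu2 (Q (h b) (h x))) (P a c))"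
    by (simp add: jac_def)
  also have "\<dots> = jac Q Q i j (h a) (h b) (h c)"
  proof -
    have "additive (\<lambda>x. at2 lam2 (Q (h a) x))" "additive (\<lambda>x. at2 lam_mu2 (Q x (h c)))"
      "additive (\<lambda>x. at2 mu2 (Q (h b) x))"
      by (intro additive_intros biadditive_left[OF assms(2)] biadditive_right[OF assms(2)])+
    then show ?thesis
      by (simp add: jac_def psubst_map_poly[OF additive_lam2 _ assms(3)]
        psubst_map_poly[OF additive_mu2 _ assms(3)] flip: assms(4))
  qed
  finally show ?thesis .
qed

text \<open>Division by t leaves A + tC + t^2 G = 0 for all nonzero t, with C = B + F A and G = F B.
  The values at 1 and -1 differ by 2C, so C = 0; then the values at 2 and 1 differ by 3G, so G = 0
  and hence A = 0. Finally B = C - F A = 0.\<close>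

lemma (in vector_space) quadratic_family_eq_0:
  assumes char: "(2::'a) \<noteq> 0" "(3::'a) \<noteq> 0"
    and F: "additive F" "\<And>c x. F (c *s x) = c *s F x"
    and eq: "\<And>t. (t *s A + t *s t *s B) + t *s F (t *s A + t *s t *s B) = 0"
  shows "A = 0" "B = 0"
proof -
  define C G where "C = B + F A" and "G = F B"
  have eq': "t *s (A + t *s C + t *s t *s G) = 0" for t
    using eq[of t] by (simp add: C_def G_def F(2) additive.add[OF F(1)] algebra_simps)
  have e: "A + t *s C + t *s t *s G = 0" if "t \<noteq> 0" for t
    using eq'[of t] that by (simp only: scale_eq_0_iff) simp
  have e1: "A + C + G = 0" using e[of 1] by simp
  have e2: "A - C + G = 0" using e[of "- 1"] by (simp add: scale_minus_left)
  have "2 *s C = (A + C + G) - (A - C + G)"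
    using scale_left_distrib[of 1 1 C] by simp
  then have C: "C = 0" using e1 e2 char(1) by simp
  have "3 *s G = (A + 2 *s C + 2 *s 2 *s G) - (A + C + G)"
    using scale_left_distrib[of 3 1 G] C by simp
  then have G: "G = 0" using e[of 2] e1 char by simp
  show "A = 0" using e1 C G by simp
  then show "B = 0" using C by (simp add: C_def additive.zero[OF F(1)])
qed

text \<open>Applied once this gives the scalars of R[\<lambda>], applied twice those of
  R[\<lambda>,\<mu>].\<close>

lemma vector_space_map_poly:
  assumes "vector_space sc"
  shows "vector_space (\<lambda>c. map_poly (sc c))"
proof -
  interpret vector_space sc by fact
  show ?thesis
    by unfold_locales
      (simp_all add: poly_eq_iff coeff_map_poly scale_left_distrib scale_right_distrib)
qed

section \<open>Lie conformal superalgebras\<close>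

context lie_conformal_superalgebra
begin

lemma additive_s [additive_intros]:
  assumes "additive h"
  shows "additive (\<lambda>x. s c (h x))"
  by unfold_locales (simp add: additive.add[OF assms] scale_right_distrib)

lemma additive_D [additive_intros]: "additive h \<Longrightarrow> additive (\<lambda>x. D s (h x))"
  unfolding D_def by (intro additive_intros)

lemma additive_cscale [additive_intros]: "additive h \<Longrightarrow> additive (\<lambda>x. cscale s c (h x))"
  unfolding cscale_def by (intro additive_intros)

lemma additive_minus_D_lam [additive_intros]:
  assumes "additive h"
  shows "additive (\<lambda>x. minus_D_lam s (h x))"
  by unfold_locales
    (simp add: minus_D_lam_def additive.add[OF additive_lam] additive.add[OF assms]
      additive.add[OF additive_map_poly[OF additive_D[OF additive_id] additive_id]])

lemma biadditive_br: "biadditive br"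
  using linear_left linear_right by (simp add: biadditive_def Vector_Spaces.linear_iff additive_def)

lemmas additive_br [additive_intros] =
  biadditive_left[OF biadditive_br] biadditive_right[OF biadditive_br]

lemma br_cscale:
  "br (cscale s c a) b = map_poly (cscale s c) (br a b)"
  "br a (cscale s c b) = map_poly (cscale s c) (br a b)"
  using linear_left linear_right by (simp_all add: Vector_Spaces.linear_iff)

lemma vector_space_cscale: "vector_space (cscale s)"
  using linear_right by (simp add: Vector_Spaces.linear_iff)

lemma cscale_D: "cscale s c (D s x) = D s (cscale s c x)"
  by (simp add: cscale_def D_def mult.commute)

section \<open>The grading and homogeneous components\<close>

lemma V_s: "x \<in> V i \<Longrightarrow> s c x \<in> V i"
  using subspace_V by (rule subspace_scale)

lemma V_D: "x \<in> V i \<Longrightarrow> D s x \<in> V i"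
  by (simp add: D_def V_s)

lemma V_cscale: "x \<in> V i \<Longrightarrow> cscale s c x \<in> V i"
  by (simp add: cscale_def V_s)

lemma V_0: "0 \<in> V i"
  using subspace_V by (rule subspace_0)

lemma V_add: "x \<in> V i \<Longrightarrow> y \<in> V i \<Longrightarrow> x + y \<in> V i"
  using subspace_V by (rule subspace_add)

lemma V_uminus: "x \<in> V i \<Longrightarrow> - x \<in> V i"
  using subspace_V by (rule subspace_neg)

lemma V_diff: "x \<in> V i \<Longrightarrow> y \<in> V i \<Longrightarrow> x - y \<in> V i"
  using subspace_V by (rule subspace_diff)

lemma V_eq_0: "x \<in> V i \<Longrightarrow> x \<in> V (i + 1) \<Longrightarrow> x = 0"
  using V_disjoint by (cases i) auto

lemma homogeneous_induct:
  assumes "\<And>i x. x \<in> V i \<Longrightarrow> P x" "\<And>x y. P x \<Longrightarrow> P y \<Longrightarrow> P (x + y)"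
  shows "P a"
  using V_sum[of a] assms by blast

text \<open>Skew-symmetry speaks of homogeneous elements only. Each element is a sum of two such, so
  an identity between additive maps extends from them to all of R.\<close>

lemma additive_eqI:
  assumes "additive g" "additive h" "\<And>i x. x \<in> V i \<Longrightarrow> g x = h x"
  shows "g a = h a"
  by (induction a rule: homogeneous_induct)
    (simp_all add: assms(3) additive.add[OF assms(1)] additive.add[OF assms(2)])

text \<open>Two candidates x, y satisfy y - x = (a - x) - (a - y), so their difference is both of
  parity i and of the opposite parity \<open>i + 1\<close>, hence 0.\<close>

lemma hcomp_eqI:
  assumes "x \<in> V i" "a - x \<in> V (i + 1)"
  shows "hcomp V i a = x"
  unfolding hcomp_def
proof (rule the_equality)
  fix y assume y: "y \<in> V i \<and> a - y \<in> V (i + 1)"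
  have "y - x \<in> V i" "y - x \<in> V (i + 1)"
    using V_diff[of y i x] V_diff[of "a - x" "i + 1" "a - y"] y assms by auto
  then show "y = x"
    using V_eq_0 by fastforce
qed (use assms in blast)

lemma hcomp_same: "a \<in> V i \<Longrightarrow> hcomp V i a = a"
  by (rule hcomp_eqI) (simp_all add: V_0)

lemma hcomp_other: "a \<in> V i \<Longrightarrow> hcomp V (i + 1) a = 0"
  by (rule hcomp_eqI, rule V_0, cases i) simp_all

lemma hcomp_in_V: "hcomp V i a \<in> V i"
  and hcomp_compl_in_V: "a - hcomp V i a \<in> V (i + 1)"
proof -
  have "\<exists>x. x \<in> V i \<and> a - x \<in> V (i + 1)"
  proof -
    obtain x y where "x \<in> V 0" "y \<in> V 1" "a = x + y"
      using V_sum by blast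
    then show ?thesis
      by (cases i) (auto intro: exI[of _ x] exI[of _ y])
  qed
  then obtain x where "x \<in> V i" "a - x \<in> V (i + 1)"
    by blast
  then show "hcomp V i a \<in> V i" "a - hcomp V i a \<in> V (i + 1)"
    by (simp_all add: hcomp_eqI)
qed

lemma additive_hcomp [additive_intros]:
  assumes "additive h"
  shows "additive (\<lambda>x. hcomp V i (h x))"
proof -
  have "hcomp V i (a + b) = hcomp V i a + hcomp V i b" for a b
  proof -
    have "(a - hcomp V i a) + (b - hcomp V i b) \<in> V (i + 1)"
      by (intro V_add hcomp_compl_in_V)
    then show ?thesis
      by (intro hcomp_eqI V_add hcomp_in_V) (simp add: algebra_simps)
  qed
  then show ?thesis
    by unfold_locales (simp add: additive.add[OF assms])
qed

lemma hcomp_s: "hcomp V i (s c a) = s c (hcomp V i a)"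
proof (rule hcomp_eqI)
  show "s c a - s c (hcomp V i a) \<in> V (i + 1)"
    using V_s[OF hcomp_compl_in_V] by (simp add: scale_right_diff_distrib)
qed (simp add: V_s hcomp_in_V)

lemma hcomp_cscale: "hcomp V i (cscale s c a) = cscale s c (hcomp V i a)"
  by (simp add: cscale_def hcomp_s)

lemma hcomp_D: "hcomp V i (D s a) = D s (hcomp V i a)"
  by (simp add: D_def hcomp_s)

text \<open>Skew-symmetry moves \<partial> to the left slot, where it becomes -\<lambda>; the
  substitution of -\<partial>-\<lambda> for \<lambda> then turns this factor into
  \<partial>+\<lambda>. Both arguments are first reduced to homogeneous ones.\<close>

lemma br_D_right: "br a (D s b) = - minus_D_lam s (br a b)"
proof (rule additive_eqI[where a = a and g = "\<lambda>a. br a (D s b)"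
      and h = "\<lambda>a. - minus_D_lam s (br a b)"])
  fix i a assume a: "a \<in> V i"
  show "br a (D s b) = - minus_D_lam s (br a b)"
  proof (rule additive_eqI[where a = b and g = "\<lambda>b. br a (D s b)"
        and h = "\<lambda>b. - minus_D_lam s (br a b)"])
    fix j b assume b: "b \<in> V j"
    have add: "additive (psubst (minus_D_lam s) (\<lambda>x. [:x:]))"
      by (intro additive_intros)
    have "br a (D s b) = - ksign i j (psubst (minus_D_lam s) (\<lambda>x. [:x:]) (- lam (br b a)))"
      using skew_symmetric[OF a V_D[OF b]] by (simp add: sesquilinear)
    also have "\<dots> = ksign i j (minus_D_lam s (psubst (minus_D_lam s) (\<lambda>x. [:x:]) (br b a)))"
      by (simp add: additive.minus[OF add] additive.minus[OF additive_ksign[OF additive_id]]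
          psubst_lam additive_intros)
    also have "\<dots> = - minus_D_lam s (br a b)"
      unfolding skew_symmetric[OF a b]
      by (simp add: additive.minus[OF additive_minus_D_lam[OF additive_id]]
          ksign_hom[OF additive_minus_D_lam[OF additive_id]])
    finally show "br a (D s b) = - minus_D_lam s (br a b)" .
  qed (intro additive_intros)+
qed (intro additive_intros)+

text \<open>A map commuting with \<partial> also commutes, on coefficients, with the operator
  -\<partial>-\<lambda>.\<close>

lemma psubst_minus_D_lam_map_poly:
  assumes "additive h" "\<And>x. h (D s x) = D s (h x)"
  shows "psubst (minus_D_lam s) (\<lambda>x. [:x:]) (map_poly h p) =
    map_poly h (psubst (minus_D_lam s) (\<lambda>x. [:x:]) p)"
proof -
  have mh: "additive (map_poly h)"
    by (intro additive_intros assms(1))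
  have "psubst (minus_D_lam s) (\<lambda>x. [:x:]) (map_poly h p) =
      psubst (minus_D_lam s) (\<lambda>x. [:h x:]) p"
    by (intro psubst_map_poly additive_intros assms(1))
  also have "\<dots> = map_poly h (psubst (minus_D_lam s) (\<lambda>x. [:x:]) p)"
  proof (rule psubst_hom[symmetric])
    show "map_poly h (minus_D_lam s x) = minus_D_lam s (map_poly h x)" for x
      by (simp add: poly_eq_iff minus_D_lam_def additive.minus[OF mh] additive.diff[OF mh]
          map_poly_lam assms(1))
        (simp add: coeff_map_poly assms(2) additive.zero[OF additive_D[OF additive_id]]
          additive.zero[OF assms(1)])
  qed (intro additive_intros mh assms(1)
      | simp add: map_poly_pCons additive.zero[OF assms(1)])+
  finally show ?thesis .
qed

text \<open>The substitution \<open>\<mu> := -\<partial> - \<lambda>\<close>.\<close>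

definition subst_mu :: "'a poly poly \<Rightarrow> 'a poly" where
  "subst_mu = psubst (minus_D_lam s) (\<lambda>p. p)"

lemma additive_subst_mu [additive_intros]: "additive h \<Longrightarrow> additive (\<lambda>x. subst_mu (h x))"
  unfolding subst_mu_def by (intro additive_intros)

lemma minus_D_lam_lam: "minus_D_lam s (lam p) = lam (minus_D_lam s p)"
  by (simp add: minus_D_lam_def lam_def map_poly_pCons additive.zero[OF additive_D[OF additive_id]])

lemma subst_mu_mu2: "subst_mu (mu2 p) = minus_D_lam s (subst_mu p)"
  unfolding subst_mu_def by (intro psubst_mu2 additive_intros)

lemma subst_mu_lam2: "subst_mu (lam2 p) = lam (subst_mu p)"
proof -
  have "subst_mu (lam2 p) = psubst (minus_D_lam s) lam p"
    unfolding subst_mu_def lam2_def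
    by (intro psubst_map_poly additive_intros)
  also have "\<dots> = lam (subst_mu p)"
    unfolding subst_mu_def
    by (rule psubst_hom[symmetric, where H = lam]) (intro additive_intros | simp add: minus_D_lam_lam)+
  finally show ?thesis .
qed

lemma subst_mu_lam_mu2: "subst_mu (lam_mu2 p) = - map_poly (D s) (subst_mu p)"
  by (simp add: lam_mu2_def additive.add[OF additive_subst_mu[OF additive_id]] subst_mu_lam2
    subst_mu_mu2 minus_D_lam_def)

lemma subst_mu_const: "subst_mu [:p:] = p"
  unfolding subst_mu_def by (intro psubst_const additive_intros)

text \<open>In the third case \<lambda>+\<mu> becomes -\<partial> and no \<lambda> survives, so the
  result is a constant polynomial.\<close>

lemma subst_mu_at2:
  "subst_mu (at2 lam2 p) = p"
  "subst_mu (at2 mu2 p) = psubst (minus_D_lam s) (\<lambda>x. [:x:]) p"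
  "subst_mu (at2 lam_mu2 p) = [:psubst (\<lambda>x. - D s x) (\<lambda>x. x) p:]"
proof -
  note add = additive_subst_mu[OF additive_id]
  show "subst_mu (at2 lam2 p) = p"
    by (simp add: hom_at2[OF additive_lam2 additive_lam add subst_mu_lam2] subst_mu_const
      psubst_lam_const)
  show "subst_mu (at2 mu2 p) = psubst (minus_D_lam s) (\<lambda>x. [:x:]) p"
    by (simp add: hom_at2[OF additive_mu2 additive_minus_D_lam[OF additive_id] add subst_mu_mu2]
        subst_mu_const)
  have "subst_mu (at2 lam_mu2 p) = psubst (\<lambda>x. - map_poly (D s) x) (\<lambda>x. subst_mu [:[:x:]:]) p"
    by (intro hom_at2 additive_intros subst_mu_lam_mu2)
  also have "\<dots> = [:psubst (\<lambda>x. - D s x) (\<lambda>x. x) p:]"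
    by (rule psubst_hom[symmetric, where H = "\<lambda>x. [:x:]"])
      (intro additive_intros | simp add: subst_mu_const map_poly_pCons
        additive.zero[OF additive_D[OF additive_id]])+
  finally show "subst_mu (at2 lam_mu2 p) = [:psubst (\<lambda>x. - D s x) (\<lambda>x. x) p:]" .
qed

end

section \<open>Even 1-cochains and the operator F\<close>

locale even_cochain = lie_conformal_superalgebra s V br
  for s :: "complex poly \<Rightarrow> 'a::ab_group_add \<Rightarrow> 'a" and V :: "bit \<Rightarrow> 'a set"
    and br :: "'a \<Rightarrow> 'a \<Rightarrow> 'a poly" +
  fixes f :: "'a \<Rightarrow> 'a poly"
  assumes f_cochain: "f \<in> cochains1_even s V"
begin

lemma additive_f [additive_intros]:
  assumes "additive h"
  shows "additive (\<lambda>x. f (h x))"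
  using f_cochain
  by unfold_locales
    (simp add: cochains1_even_def Vector_Spaces.linear_iff additive.add[OF assms])

lemma f_cscale: "f (cscale s c a) = map_poly (cscale s c) (f a)"
  using f_cochain by (simp add: cochains1_even_def Vector_Spaces.linear_iff)

lemma f_D: "f (D s a) = - lam (f a)"
  using f_cochain by (simp add: cochains1_even_def)

lemma f_graded: "a \<in> V i \<Longrightarrow> coeff (f a) n \<in> V i"
  using f_cochain by (simp add: cochains1_even_def)

definition F :: "'a \<Rightarrow> 'a" where
  "F = at_minus_D s f"

lemma F_eq: "F a = psubst (\<lambda>x. - D s x) (\<lambda>x. x) (f a)"
  by (simp add: F_def at_minus_D_def)

lemma additive_F [additive_intros]: "additive h \<Longrightarrow> additive (\<lambda>x. F (h x))"
  unfolding F_eq by (intro additive_intros)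

lemma F_cscale: "F (cscale s c a) = cscale s c (F a)"
proof -
  have "F (cscale s c a) = psubst (\<lambda>x. - D s x) (\<lambda>x. cscale s c x) (f a)"
    unfolding F_eq f_cscale by (intro psubst_map_poly additive_intros)
  also have "\<dots> = cscale s c (F a)"
    unfolding F_eq
    by (rule psubst_hom[symmetric, where H = "cscale s c"])
      (intro additive_intros | simp add: cscale_D additive.minus[OF additive_cscale[OF additive_id]])+
  finally show ?thesis .
qed

text \<open>\<open>f (D s a)\<close> carries the factor -\<lambda>, which becomes \<partial> at
  \<lambda> = -\<partial>.\<close>

lemma F_D: "F (D s a) = D s (F a)"
proof -
  have add: "additive (psubst (\<lambda>x. - D s x) (\<lambda>x :: 'a. x))" "additive (\<lambda>x. - D s x)"
    by (intro additive_intros)+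
  then show ?thesis
    by (simp add: F_eq f_D additive.minus[OF add(1)] psubst_lam additive_id)
qed

lemma F_V: "a \<in> V i \<Longrightarrow> F a \<in> V i"
  unfolding F_eq by (rule psubst_closed) (auto intro: f_graded V_0 V_add V_uminus V_D)

text \<open>A factor \<lambda> outside the bracket equals -\<partial> on its left argument, and F is
  f evaluated at -\<partial>.\<close>

lemma psubst_lam_br: "psubst lam (\<lambda>x. br x b) (f a) = br (F a) b"
  unfolding F_eq
  by (rule psubst_hom[symmetric, where H = "\<lambda>x. br x b"])
    (intro additive_intros | simp add: additive.minus[OF biadditive_left[OF biadditive_br additive_id]]
      sesquilinear)+

text \<open>The counterpart in the right slot: by \<open>br_D_right\<close> a factor
  -\<partial>-\<lambda> outside equals -\<partial> on the right argument.\<close>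

lemma psubst_minus_D_lam_br: "psubst (minus_D_lam s) (br a) (f b) = br a (F b)"
  unfolding F_eq
  by (rule psubst_hom[symmetric, where H = "br a"])
    (intro additive_intros | simp add: additive.minus[OF biadditive_right[OF biadditive_br additive_id]]
      br_D_right)+

lemma psubst_lam_F: "psubst lam (\<lambda>z. [:F z:]) p = map_poly F p"
proof -
  have "psubst lam (\<lambda>x. [:x:]) (map_poly F p) = psubst lam (\<lambda>z. [:F z:]) p"
    by (intro psubst_map_poly additive_intros)
  then show ?thesis
    by (simp add: psubst_lam_const)
qed

lemma subst_mu_f: "subst_mu (psubst lam2 (\<lambda>z. at2 lam_mu2 (f z)) p) = map_poly F p"
proof -
  have "subst_mu (psubst lam2 (\<lambda>z. at2 lam_mu2 (f z)) p) = psubst lam (\<lambda>z. [:F z:]) p"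
    by (rule psubst_hom) (intro additive_intros | simp add: subst_mu_lam2 subst_mu_at2 F_eq)+
  then show ?thesis
    by (simp add: psubst_lam_F)
qed

section \<open>The bracket N\<close>

abbreviation N :: "'a \<Rightarrow> 'a \<Rightarrow> 'a poly" where
  "N \<equiv> bracket_N s br f"

lemma N_eq: "N a b = br (F a) b + br a (F b) - map_poly F (br a b)"
  by (simp add: bracket_N_def psubst_lam_br F_def)

lemma biadditive_N: "biadditive N"
proof -
  have *: "N a b = br (F a) b + br a (F b) + - map_poly F (br a b)" for a b
    by (simp add: N_eq)
  show ?thesis
    unfolding biadditive_def * by (intro conjI allI additive_intros)
qed

lemma map_poly_F_cscale: "map_poly F (map_poly (cscale s c) p) = map_poly (cscale s c) (map_poly F p)"
  by (simp add: poly_eq_iff coeff_map_poly F_cscale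
    additive.zero[OF additive_cscale[OF additive_id]] additive.zero[OF additive_F[OF additive_id]])

lemma N_cscale:
  "N (cscale s c a) b = map_poly (cscale s c) (N a b)"
  "N a (cscale s c b) = map_poly (cscale s c) (N a b)"
proof -
  have "additive (map_poly (cscale s c))"
    by (intro additive_intros)
  note * = additive.add[OF this] additive.diff[OF this]
  show "N (cscale s c a) b = map_poly (cscale s c) (N a b)"
    "N a (cscale s c b) = map_poly (cscale s c) (N a b)"
    by (simp_all add: N_eq * F_cscale br_cscale map_poly_F_cscale)
qed

lemma N_graded:
  assumes "a \<in> V i" "b \<in> V j"
  shows "coeff (N a b) n \<in> V (i + j)"
  unfolding N_eq coeff_add coeff_diff
    coeff_map_poly[where f = F, OF additive.zero[OF additive_F[OF additive_id]]]
  by (intro V_add V_diff graded F_V assms)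

lemma N_D: "N (D s a) b = - lam (N a b)"
proof -
  have add: "additive (map_poly F)"
    by (intro additive_intros)
  show ?thesis
    by (simp add: N_eq F_D sesquilinear additive.minus[OF add] additive.add[OF additive_lam]
      additive.diff[OF additive_lam] map_poly_lam additive_F additive_id)
qed

text \<open>F preserves parity, so all three brackets in N carry the same sign. Skew-symmetry
  interchanges the first two, and F commutes with the substitution in the third.\<close>

lemma N_skew:
  assumes a: "a \<in> V i" and b: "b \<in> V j"
  shows "N a b = - ksign i j (psubst (minus_D_lam s) (\<lambda>x. [:x:]) (N b a))"
proof -
  let ?S = "psubst (minus_D_lam s) (\<lambda>x. [:x:])"
  have S: "additive ?S" and mF: "additive (map_poly F)"
    by (intro additive_intros)+
  have SF: "?S (map_poly F p) = map_poly F (?S p)" for p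
    by (intro psubst_minus_D_lam_map_poly F_D additive_intros)
  show ?thesis
    unfolding N_eq skew_symmetric[OF F_V[OF a] b] skew_symmetric[OF a F_V[OF b]]
      skew_symmetric[OF a b] additive.diff[OF S] additive.add[OF S] SF
    by (simp add: additive.minus[OF mF] ksign_hom[OF mF] additive.diff[OF additive_ksign[OF additive_id]]
      additive.add[OF additive_ksign[OF additive_id]])
qed

section \<open>The coboundary of f as an even 2-cochain\<close>

abbreviation dh :: "bit \<Rightarrow> bit \<Rightarrow> 'a \<Rightarrow> 'a \<Rightarrow> 'a poly poly" where
  "dh \<equiv> dhat_homogeneous br f"

text \<open>The parities i, j are free parameters of \<open>dh\<close>, so additivity holds for
  arbitrary arguments; homogeneity enters only with the grading and skew-symmetry.\<close>

lemma additive_dh [additive_intros]: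
  "additive h \<Longrightarrow> additive (\<lambda>a. dh i j (h a) b)"
  "additive h \<Longrightarrow> additive (\<lambda>b. dh i j a (h b))"
  unfolding dhat_homogeneous_def by (intro additive_intros; assumption)+

lemma additive_br_terms:
  "additive (\<lambda>x. at2 lam2 (br a x))" "additive (\<lambda>x. at2 mu2 (br a x))"
  "additive (\<lambda>z. at2 lam_mu2 (f z))"
  by (intro additive_intros)+

lemmas minus_hom =
  additive.minus[OF additive_lam] additive.minus[OF additive_lam2] additive.minus[OF additive_mu2]
  additive.minus[OF additive_at2[OF additive_lam2 additive_id]]
  additive.minus[OF additive_at2[OF additive_mu2 additive_id]]
  additive.minus[OF additive_at2[OF additive_lam_mu2 additive_id]]
  additive.minus[OF additive_psubst[OF additive_lam2 additive_br_terms(1) additive_id]]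
  additive.minus[OF additive_psubst[OF additive_lam2 additive_br_terms(2) additive_id]]
  additive.minus[OF additive_psubst[OF additive_lam2 additive_br_terms(3) additive_id]]
  additive.minus[OF additive_psubst[OF additive_mu2 additive_br_terms(1) additive_id]]
  additive.minus[OF additive_ksign[OF additive_id]]

text \<open>In the three terms \<partial> turns into -\<lambda> by sesquilinearity of the outer
  bracket, by \<open>f_D\<close>, and by sesquilinearity of the inner bracket respectively.\<close>

lemma dh_D_left: "dh i j (D s a) b = - lam2 (dh i j a b)"
proof -
  have "psubst mu2 (\<lambda>y. at2 lam2 (br (D s a) y)) p =
      - lam2 (psubst mu2 (\<lambda>y. at2 lam2 (br a y)) p)" for p
    by (rule psubst_hom[symmetric, where H = "\<lambda>x. - lam2 x"])
      (intro additive_intros | simp add: minus_hom sesquilinear at2_lam lam2_mu2 additive_lam2)+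
  then show ?thesis
    by (simp add: dhat_homogeneous_def f_D sesquilinear minus_hom
      psubst_lam[OF additive_lam2 additive_br_terms(2)]
      psubst_lam[OF additive_lam2 additive_br_terms(3)]
      additive.diff[OF additive_lam2] ksign_hom[OF additive_lam2])
qed

text \<open>Under f with variable \<lambda>+\<mu>, the operator \<partial> acts as
  -(\<lambda>+\<mu>). Hence -\<partial>-\<lambda> acts as (\<lambda>+\<mu>)-\<lambda> =
  \<mu>.\<close>

lemma psubst_minus_D_lam_f:
  "psubst lam2 (\<lambda>z. at2 lam_mu2 (f z)) (minus_D_lam s p) =
    mu2 (psubst lam2 (\<lambda>z. at2 lam_mu2 (f z)) p)"
proof -
  let ?G = "psubst lam2 (\<lambda>z. at2 lam_mu2 (f z))"
  have G: "additive ?G"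
    by (intro additive_intros)
  have "?G (map_poly (D s) p) = psubst lam2 (\<lambda>z. at2 lam_mu2 (f (D s z))) p"
    by (intro psubst_map_poly additive_intros)
  also have "\<dots> = - lam_mu2 (?G p)"
  proof (rule psubst_hom[symmetric, where H = "\<lambda>x. - lam_mu2 x"])
    show "- lam_mu2 (lam2 x) = lam2 (- lam_mu2 x)" for x :: "'a poly poly"
      by (simp add: lam_mu2_def minus_hom lam2_mu2 additive.add[OF additive_lam2]
        additive.diff[OF additive_lam2])
    show "- lam_mu2 (at2 lam_mu2 (f x)) = at2 lam_mu2 (f (D s x))" for x
      by (simp add: f_D minus_hom at2_lam[OF additive_lam_mu2])
  qed (intro additive_intros)+
  finally show ?thesis
    by (simp add: minus_D_lam_def additive.diff[OF G] minus_hom lam_mu2_def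
      psubst_lam[OF additive_lam2 additive_br_terms(3)])
qed

lemma dh_D_right: "dh i j a (D s b) = - mu2 (dh i j a b)"
proof -
  have "psubst lam2 (\<lambda>y. at2 mu2 (br (D s b) y)) p =
      - mu2 (psubst lam2 (\<lambda>y. at2 mu2 (br b y)) p)" for p
    by (rule psubst_hom[symmetric, where H = "\<lambda>x. - mu2 x"])
      (intro additive_intros | simp add: minus_hom sesquilinear at2_lam lam2_mu2 additive_mu2)+
  then show ?thesis
    by (simp add: dhat_homogeneous_def f_D br_D_right minus_hom psubst_minus_D_lam_f
      psubst_lam[OF additive_mu2 additive_br_terms(1)]
      additive.diff[OF additive_mu2] ksign_hom[OF additive_mu2])
qed

lemma dh_cscale:
  "dh i j (cscale s c a) b = map_poly2 (cscale s c) (dh i j a b)"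
  "dh i j a (cscale s c b) = map_poly2 (cscale s c) (dh i j a b)"
proof -
  have add: "additive (cscale s c)" "additive (map_poly2 (cscale s c))"
    by (intro additive_intros)+
  show "dh i j (cscale s c a) b = map_poly2 (cscale s c) (dh i j a b)"
    "dh i j a (cscale s c b) = map_poly2 (cscale s c) (dh i j a b)"
    by (simp_all add: dhat_homogeneous_def br_cscale f_cscale additive.diff[OF add(2)]
      ksign_hom[OF add(2)] at2_lam_map_poly[OF add(1)] map_poly2_psubst[OF add(1)]
      psubst_map_poly[OF additive_lam2 _ add(1)] psubst_map_poly[OF additive_mu2 _ add(1)]
      additive_br_terms)
qed

lemma dh_graded:
  assumes a: "a \<in> V i" and b: "b \<in> V j"
  shows "coeff (coeff (dh i j a b) m) n \<in> V (i + j)"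
proof -
  \<comment> \<open>The set \<open>W k\<close> is closed under every operation from which
    \<open>dh\<close> is built, so the claim becomes a closure computation through
    \<open>psubst_closed\<close>.\<close>
  define W where "W k = {q. \<forall>m n. coeff (coeff q m) n \<in> V k}" for k
  have W0: "0 \<in> W k" for k
    by (simp add: W_def V_0)
  have Wadd: "p + q \<in> W k" if "p \<in> W k" "q \<in> W k" for p q k
    using that by (simp add: W_def V_add)
  have Wneg: "- p \<in> W k" if "p \<in> W k" for p k
    using that by (simp add: W_def V_uminus)
  have Wksign: "ksign i j p \<in> W k" if "p \<in> W k" for p k
    using that by (simp add: ksign_def Wneg)
  have Wlam2: "lam2 p \<in> W k" if "p \<in> W k" for p k
    using that by (simp add: W_def lam2_def coeff_map_poly lam_def coeff_pCons V_0 split: nat.split)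
  have Wmu2: "mu2 p \<in> W k" if "p \<in> W k" for p k
    using that by (simp add: W_def mu2_def coeff_pCons V_0 split: nat.split)
  have Wlam_mu2: "lam_mu2 p \<in> W k" if "p \<in> W k" for p k
    using that by (simp add: lam_mu2_def Wadd Wlam2 Wmu2)
  have Wconst: "[:[:x:]:] \<in> W k" if "x \<in> V k" for x k
    using that by (simp add: W_def coeff_pCons V_0 split: nat.split)
  have Wat2: "at2 T p \<in> W k" if "\<And>n. coeff p n \<in> V k" "\<And>q. q \<in> W k \<Longrightarrow> T q \<in> W k" for T p k
    unfolding at2_def by (intro psubst_closed Wconst that W0 Wadd)
  have A: "psubst mu2 (\<lambda>y. at2 lam2 (br a y)) (f b) \<in> W (i + j)"
    by (intro psubst_closed Wat2 Wmu2 Wlam2 W0 Wadd graded a f_graded b)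
  have "psubst lam2 (\<lambda>x. at2 mu2 (br b x)) (f a) \<in> W (j + i)"
    by (intro psubst_closed Wat2 Wmu2 Wlam2 W0 Wadd graded a f_graded b)
  then have B: "psubst lam2 (\<lambda>x. at2 mu2 (br b x)) (f a) \<in> W (i + j)"
    by (simp only: add.commute)
  have C: "psubst lam2 (\<lambda>z. at2 lam_mu2 (f z)) (br a b) \<in> W (i + j)"
    by (intro psubst_closed Wat2 Wlam_mu2 Wlam2 W0 Wadd f_graded graded a b)
  have "dh i j a b \<in> W (i + j)"
    unfolding dhat_homogeneous_def diff_conv_add_uminus
    by (intro Wadd Wneg Wksign A B C)
  then show ?thesis
    by (simp only: W_def mem_Collect_eq)
qed

text \<open>The exchange of \<lambda> and \<mu> interchanges the first two terms up to sign and
  fixes \<lambda>+\<mu>. In the third term skew-symmetry of the bracket puts -\<partial>-\<lambda>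
  for \<lambda>, which by \<open>psubst_minus_D_lam_f\<close> acts as \<mu>.\<close>

lemma dh_skew:
  assumes a: "a \<in> V i" and b: "b \<in> V j"
  shows "dh i j a b = - ksign i j (swap2 (dh j i b a))"
proof -
  have sw: "swap2 (psubst mu2 (\<lambda>y. at2 lam2 (br b y)) p) = psubst lam2 (\<lambda>y. at2 mu2 (br b y)) p"
    "swap2 (psubst lam2 (\<lambda>y. at2 mu2 (br a y)) p) = psubst mu2 (\<lambda>y. at2 lam2 (br a y)) p"
    "swap2 (psubst lam2 (\<lambda>z. at2 lam_mu2 (f z)) p) = psubst mu2 (\<lambda>z. at2 lam_mu2 (f z)) p" for p
    by (rule psubst_hom; (intro additive_intros | simp add: swap2_mu2 swap2_lam2 swap2_at2))+
  let ?G = "psubst lam2 (\<lambda>z. at2 lam_mu2 (f z))"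
  have "?G (psubst (minus_D_lam s) (\<lambda>x. [:x:]) p) = psubst mu2 (\<lambda>z. at2 lam_mu2 (f z)) p" for p
  proof (rule psubst_hom)
    show "?G [:x:] = at2 lam_mu2 (f x)" for x
      by (intro psubst_const additive_intros)
  qed (intro additive_intros psubst_minus_D_lam_f)+
  moreover have "additive ?G"
    by (intro additive_intros)
  ultimately have "?G (br a b) = - ksign i j (psubst mu2 (\<lambda>z. at2 lam_mu2 (f z)) (br b a))"
    unfolding skew_symmetric[OF a b] by (simp add: additive.minus ksign_hom)
  then show ?thesis
    by (simp add: dhat_homogeneous_def additive.diff[OF additive_swap2] ksign_hom[OF additive_swap2]
      sw ksign_commute[of j i] additive.diff[OF additive_ksign[OF additive_id]])
qed

text \<open>The other three summands of \<open>dhat\<close> have a zero component as an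
  argument.\<close>

lemma dhat_homogeneous_eq:
  assumes "a \<in> V i" "b \<in> V j"
  shows "dhat V br f a b = dh i j a b"
proof -
  have "dh i j 0 y = 0" "dh i j x 0 = 0" for i j x y
    using additive_dh[OF additive_id, THEN additive.zero] by simp_all
  then show ?thesis
    using assms hcomp_same[OF assms(1)] hcomp_same[OF assms(2)] hcomp_other[OF assms(1)]
      hcomp_other[OF assms(2)]
    by (cases i; cases j) (simp_all add: dhat_def)
qed

lemma additive_dhat [additive_intros]:
  "additive h \<Longrightarrow> additive (\<lambda>a. dhat V br f (h a) b)"
  "additive h \<Longrightarrow> additive (\<lambda>b. dhat V br f a (h b))"
proof -
  have *: "dhat V br f a b = (dh 0 0 (hcomp V 0 a) (hcomp V 0 b) + dh 0 1 (hcomp V 0 a) (hcomp V 1 b))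
    + (dh 1 0 (hcomp V 1 a) (hcomp V 0 b) + dh 1 1 (hcomp V 1 a) (hcomp V 1 b))" for a b
    by (simp add: dhat_def)
  show "additive (\<lambda>a. dhat V br f (h a) b)" "additive (\<lambda>b. dhat V br f a (h b))" if "additive h"
    unfolding * using that by (intro additive_intros; assumption)+
qed

lemma dhat_cochain: "dhat V br f \<in> cochains2_even s V"
proof -
  interpret lin: additive "dhat V br f a" for a
    by (intro additive_intros)
  interpret lin': additive "\<lambda>a. dhat V br f a b" for b
    by (intro additive_intros)
  have cs: "dhat V br f (cscale s c a) b = map_poly2 (cscale s c) (dhat V br f a b)"
    "dhat V br f a (cscale s c b) = map_poly2 (cscale s c) (dhat V br f a b)" for a b c
  proof -
    have "additive (map_poly2 (cscale s c))"
      by (intro additive_intros)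
    then show "dhat V br f (cscale s c a) b = map_poly2 (cscale s c) (dhat V br f a b)"
      "dhat V br f a (cscale s c b) = map_poly2 (cscale s c) (dhat V br f a b)"
      by (simp_all add: dhat_def additive.add hcomp_cscale dh_cscale)
  qed
  have D: "dhat V br f (D s a) b = - lam2 (dhat V br f a b)"
    "dhat V br f a (D s b) = - mu2 (dhat V br f a b)" for a b
    by (simp_all add: dhat_def hcomp_D dh_D_left dh_D_right additive.add[OF additive_lam2]
      additive.add[OF additive_mu2])
  have "coeff (coeff (dhat V br f a b) m) n \<in> V (i + j)"
    and "dhat V br f a b = - ksign i j (swap2 (dhat V br f b a))"
    if "a \<in> V i" "b \<in> V j" for a b i j m n
    unfolding dhat_homogeneous_eq[OF that] dhat_homogeneous_eq[OF that(2,1)]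
    by (rule dh_graded[OF that] dh_skew[OF that])+
  then show ?thesis
    unfolding cochains2_even_def Vector_Spaces.linear_iff mem_Collect_eq
    by (intro conjI allI impI vector_space_cscale vector_space_map_poly lin.add lin'.add cs D)
qed

text \<open>For homogeneous a and b the three terms are substituted one by one. The second yields
  its bracket in reversed order, and the sign from skew-symmetry cancels the sign in front of that
  term.\<close>

lemma at_minus_D_lam_dhat: "at_minus_D_lam s (dhat V br f) a b = N a b"
proof -
  have "subst_mu (dhat V br f a b) = N a b"
  proof (rule additive_eqI[where a = a and g = "\<lambda>a. subst_mu (dhat V br f a b)" and h = "\<lambda>a. N a b"])
    fix i a assume a: "a \<in> V i"
    show "subst_mu (dhat V br f a b) = N a b"
    proof (rule additive_eqI[where a = b and g = "\<lambda>b. subst_mu (dhat V br f a b)" and h = "N a"])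
      fix j b assume b: "b \<in> V j"
      note add = additive_subst_mu[OF additive_id]
      have "subst_mu (psubst mu2 (\<lambda>y. at2 lam2 (br a y)) (f b)) =
          psubst (minus_D_lam s) (br a) (f b)"
        by (rule psubst_hom) (intro additive_intros | simp add: subst_mu_mu2 subst_mu_at2)+
      then have A: "subst_mu (psubst mu2 (\<lambda>y. at2 lam2 (br a y)) (f b)) = br a (F b)"
        by (simp add: psubst_minus_D_lam_br)
      have "subst_mu (psubst lam2 (\<lambda>x. at2 mu2 (br b x)) (f a)) =
          psubst lam (\<lambda>x. psubst (minus_D_lam s) (\<lambda>x. [:x:]) (br b x)) (f a)"
        by (rule psubst_hom) (intro additive_intros | simp add: subst_mu_lam2 subst_mu_at2)+
      \<comment> \<open>Since f is even, all coefficients of \<open>f a\<close> have parity i, so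
        one and the same sign serves for every one of them.\<close>
      also have "\<dots> = psubst lam (\<lambda>x. - ksign i j (br x b)) (f a)"
        by (rule psubst_cong) (simp add: skew_symmetric[OF f_graded[OF a] b] minus_hom)
      also have "\<dots> = - ksign i j (psubst lam (\<lambda>x. br x b) (f a))"
        by (rule psubst_hom[symmetric, where H = "\<lambda>x. - ksign i j x"])
          (intro additive_intros | simp add: minus_hom ksign_hom[OF additive_lam])+
      also have "\<dots> = - ksign i j (br (F a) b)"
        by (simp add: psubst_lam_br)
      finally have B: "subst_mu (psubst lam2 (\<lambda>x. at2 mu2 (br b x)) (f a)) =
          - ksign i j (br (F a) b)" .
      show "subst_mu (dhat V br f a b) = N a b"
        by (simp add: dhat_homogeneous_eq[OF a b] dhat_homogeneous_def additive.diff[OF add]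
          ksign_hom[OF add] A B subst_mu_f minus_hom N_eq)
    qed (intro additive_intros biadditive_right[OF biadditive_N])+
  qed (intro additive_intros biadditive_left[OF biadditive_N])+
  then show ?thesis
    by (simp add: at_minus_D_lam_def subst_mu_def)
qed

end

section \<open>Nijenhuis operators: the deformed bracket and its triviality\<close>

locale nijenhuis = even_cochain +
  assumes nijenhuis: "nijenhuis_operator s br f"
begin

lemma br_F_F: "br (F a) (F b) = map_poly F (N a b)"
proof -
  \<comment> \<open>The substitution works from the inside: first for fixed y, where only \<lambda>
    occurs, then over the coefficients of \<open>f b\<close>, where \<mu> enters.\<close>
  have "subst_mu (psubst lam2 (\<lambda>x. at2 lam2 (br x y)) (f a)) = psubst lam (\<lambda>x. br x y) (f a)" for y
    by (rule psubst_hom) (intro additive_intros | simp add: subst_mu_lam2 subst_mu_at2)+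
  then have "subst_mu (psubst lam2 (\<lambda>x. at2 lam2 (br x y)) (f a)) = br (F a) y" for y
    by (simp add: psubst_lam_br)
  then have "subst_mu (psubst mu2 (\<lambda>y. psubst lam2 (\<lambda>x. at2 lam2 (br x y)) (f a)) (f b)) =
      psubst (minus_D_lam s) (br (F a)) (f b)"
    by (intro psubst_hom) (intro additive_intros | simp add: subst_mu_mu2)+
  then show ?thesis
    using nijenhuis by (simp add: nijenhuis_operator_def subst_mu_f psubst_minus_D_lam_br)
qed

definition dbr :: "complex \<Rightarrow> 'a \<Rightarrow> 'a \<Rightarrow> 'a poly" where
  "dbr t a b = br a b + map_poly (cscale s t) (N a b)"

text \<open>This is \<open>T_map s f t\<close> evaluated at -\<partial>, as verified in
  \<open>trivial_deformation_dhat\<close>.\<close>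

definition T :: "complex \<Rightarrow> 'a \<Rightarrow> 'a" where
  "T t a = a + cscale s t (F a)"

lemma deformed_bracket_dhat: "deformed_bracket s br (dhat V br f) t = dbr t"
  by (simp add: fun_eq_iff deformed_bracket_def dbr_def at_minus_D_lam_dhat)

lemma biadditive_dbr: "biadditive (dbr t)"
  unfolding biadditive_def dbr_def
  by (intro conjI allI additive_intros biadditive_left[OF biadditive_N]
    biadditive_right[OF biadditive_N])

lemma additive_T [additive_intros]: "additive (T t)"
  unfolding T_def by (intro additive_intros)

lemma T_V: "a \<in> V i \<Longrightarrow> T t a \<in> V i"
  by (simp add: T_def V_add V_cscale F_V)

lemma map_poly_T: "map_poly (T t) p = p + map_poly (cscale s t) (map_poly F p)"
  by (simp add: poly_eq_iff coeff_map_poly T_def additive.zero[OF additive_cscale[OF additive_id]]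
    additive.zero[OF additive_F[OF additive_id]])

lemma map_poly2_T:
  "map_poly2 (T t) p = p + map_poly2 (cscale s t) (map_poly2 F p)"
  by (simp add: poly_eq_iff[where 'a = "'a poly"] coeff_map_poly map_poly_T)

text \<open>Both sides are quadratic in t. The linear terms agree by \<open>N_eq\<close>, the
  quadratic ones by \<open>br_F_F\<close>.\<close>

lemma T_dbr: "map_poly (T t) (dbr t a b) = br (T t a) (T t b)"
proof -
  have "additive (map_poly F)" "additive (map_poly (cscale s t))"
    by (intro additive_intros)+
  note * = this[THEN additive.add] this[THEN additive.diff]
  note ** = additive.add[OF additive_br(1)[OF additive_id]] additive.add[OF additive_br(2)[OF additive_id]]
  show ?thesis
    by (simp add: map_poly_T dbr_def T_def * ** br_cscale map_poly_F_cscale flip: br_F_F)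
      (simp add: N_eq *)
qed

lemma jac_dbr:
  assumes a: "a \<in> V i" and b: "b \<in> V j"
  shows "jac (dbr t) (dbr t) i j a b c = 0"
proof -
  let ?K = "\<lambda>t. map_poly2 (cscale s t)"
  have add: "additive (cscale s t)" for t
    by (intro additive_intros)
  interpret K: vector_space ?K
    by (intro vector_space_map_poly vector_space_cscale)
  have br0: "jac br br i j a b c = 0" if "a \<in> V i" "b \<in> V j" for a b c
    using jacobi[OF that, of c] by (simp add: jac_def)
  have bi: "biadditive (\<lambda>a b. map_poly (cscale s t) (N a b))" for t
    unfolding biadditive_def
    by (intro conjI allI additive_intros biadditive_left[OF biadditive_N]
      biadditive_right[OF biadditive_N])
  \<comment> \<open>These are the coefficients of t and t^2 in the Jacobiator of
    \<open>dbr t\<close>; its constant term is the Jacobiator of \<open>br\<close>, which is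
    0.\<close>
  let ?A = "jac br N i j a b c + jac N br i j a b c"
  let ?B = "jac N N i j a b c"
  have J: "jac (dbr t) (dbr t) i j a b c = ?K t ?A + ?K t (?K t ?B)" for t
  proof -
    have "jac (dbr t) (dbr t) i j a b c = (jac br br i j a b c + ?K t (jac br N i j a b c))
        + (?K t (jac N br i j a b c) + ?K t (?K t ?B))"
      by (simp add: dbr_def[abs_def] jac_add_left[OF biadditive_br bi] K.scale_right_distrib
        map_poly2_jac[OF biadditive_N add, symmetric]
        jac_add_right[OF biadditive_br] jac_scale_right[OF biadditive_br add br_cscale]
        jac_add_right[OF biadditive_N] jac_scale_right[OF biadditive_N add N_cscale])
    then show ?thesis
      by (simp add: br0[OF a b] K.scale_right_distrib)
  qed
  have F: "additive (map_poly2 F)"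
    by (intro additive_intros)
  have F': "map_poly2 F (?K t x) = ?K t (map_poly2 F x)" for t x
    by (simp add: poly_eq_iff[where 'a = "'a poly"] coeff_map_poly map_poly_F_cscale)
  \<comment> \<open>The right-hand side vanishes by \<open>br0\<close>, because \<open>T t a\<close>
    and \<open>T t b\<close> keep the parities i and j.\<close>
  have "map_poly2 (T t) (jac (dbr t) (dbr t) i j a b c) = jac br br i j (T t a) (T t b) (T t c)" for t
    by (intro map_poly2_jac_hom biadditive_dbr biadditive_br additive_T T_dbr)
  then have "(?K t ?A + ?K t (?K t ?B)) + ?K t (map_poly2 F (?K t ?A + ?K t (?K t ?B))) = 0" for t
    unfolding J map_poly2_T by (simp add: br0 T_V a b)
  \<comment> \<open>The two skipped premises say that 2 and 3 are nonzero in the complex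
    numbers.\<close>
  then have "?A = 0" "?B = 0"
    using K.quadratic_family_eq_0[OF _ _ F F', of ?A ?B] by simp_all
  then show ?thesis
    unfolding J by simp
qed

lemma lie_conformal_superalgebra_dbr: "lie_conformal_superalgebra s V (dbr t)"
proof -
  interpret K: vector_space "\<lambda>t. map_poly (cscale s t)"
    by (intro vector_space_map_poly vector_space_cscale)
  have lin: "additive (\<lambda>a. dbr t a b)" "additive (dbr t a)" for a b
    using biadditive_dbr by (simp_all add: biadditive_def)
  have cs: "dbr t (cscale s c a) b = map_poly (cscale s c) (dbr t a b)"
    "dbr t a (cscale s c b) = map_poly (cscale s c) (dbr t a b)" for a b c
    by (simp_all add: dbr_def br_cscale N_cscale K.scale_right_distrib mult.commute)
  have cs0: "cscale s t 0 = 0"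
    by (rule additive.zero) (intro additive_intros)
  have add: "additive (cscale s t)" "additive (map_poly (cscale s t))"
      "additive (psubst (minus_D_lam s) (\<lambda>x :: 'a. [:x:]))"
    by (intro additive_intros)+
  show ?thesis
  proof (intro lie_conformal_superalgebra.intro graded_module_axioms
      lie_conformal_superalgebra_axioms.intro)
    show "Vector_Spaces.linear (cscale s) (\<lambda>c. map_poly (cscale s c)) (\<lambda>a. dbr t a b)"
      "Vector_Spaces.linear (cscale s) (\<lambda>c. map_poly (cscale s c)) (dbr t a)" for a b
      unfolding Vector_Spaces.linear_iff
      by (intro conjI allI vector_space_cscale vector_space_map_poly additive.add[OF lin(1)]
        additive.add[OF lin(2)] cs)+
  next
    fix i j a b n assume a: "a \<in> V i" and b: "b \<in> V j"
    show "coeff (dbr t a b) n \<in> V (i + j)"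
      unfolding dbr_def coeff_add coeff_map_poly[where f = "cscale s t", OF cs0]
      by (intro V_add V_cscale graded N_graded a b)
    \<comment> \<open>Both \<open>br\<close> and N are skew-symmetric, and the scalar t passes
      through the substitution because it commutes with \<partial>.\<close>
    show "dbr t a b = - ksign i j (psubst (minus_D_lam s) (\<lambda>x. [:x:]) (dbr t b a))"
      unfolding dbr_def skew_symmetric[OF a b] N_skew[OF a b] additive.add[OF add(3)]
        psubst_minus_D_lam_map_poly[OF add(1) cscale_D]
      by (simp add: additive.minus[OF add(2)] ksign_hom[OF add(2)]
        additive.add[OF additive_ksign[OF additive_id]])
    show "psubst mu2 (\<lambda>x. at2 lam2 (dbr t a x)) (dbr t b c) =
        psubst lam2 (\<lambda>x. at2 lam_mu2 (dbr t x c)) (dbr t a b)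
        + ksign i j (psubst lam2 (\<lambda>x. at2 mu2 (dbr t b x)) (dbr t a c))" for c
      using jac_dbr[OF a b, of t c] by (simp add: jac_def algebra_simps)
  next
    show "dbr t (D s a) b = - lam (dbr t a b)" for a b
      by (simp add: dbr_def sesquilinear N_D additive.minus[OF add(2)] additive.add[OF additive_lam]
        map_poly_lam[OF add(1)])
  qed
qed

text \<open>The witness is f itself, the same for every t. Both sides are rewritten in terms of
  \<open>T t\<close>, and what remains is \<open>T_dbr\<close>.\<close>

lemma trivial_deformation_dhat: "trivial_deformation s V br (dhat V br f)"
proof -
  have T: "at_minus_D s (T_map s f t) = T t" for t
  proof
    fix a
    have add: "additive (\<lambda>x. - D s x)" "additive (psubst (\<lambda>x. - D s x) (\<lambda>x :: 'a. x))"
      by (intro additive_intros)+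
    show "at_minus_D s (T_map s f t) a = T t a"
      by (simp add: at_minus_D_def T_map_def T_def additive.add[OF add(2)]
        psubst_const[OF add(1) additive_id] F_eq[symmetric] f_cscale[symmetric] F_cscale)
  qed
  have "psubst lam (\<lambda>x. br x y) (T_map s f t a) = br (T t a) y" for t a y
  proof -
    have add: "additive (\<lambda>x. br x y)" "additive (psubst lam (\<lambda>x. br x y))"
      by (intro additive_intros)+
    show ?thesis
      by (simp add: T_map_def T_def additive.add[OF add(2)] additive.add[OF add(1)]
        psubst_const[OF additive_lam add(1)] psubst_lam_br f_cscale[symmetric] F_cscale)
  qed
  then show ?thesis
    unfolding trivial_deformation_def
    by (intro bexI[OF _ f_cochain]) (simp add: T T_dbr deformed_bracket_dhat)
qed

end

theorem theorem3p7:
  fixes s :: "complex poly \<Rightarrow> 'a::ab_group_add \<Rightarrow> 'a"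
    and V :: "bit \<Rightarrow> 'a set"
    and br :: "'a \<Rightarrow> 'a \<Rightarrow> 'a poly"
    and f :: "'a \<Rightarrow> 'a poly"
  assumes "lie_conformal_superalgebra s V br"
    and "f \<in> cochains1_even s V"
    and "nijenhuis_operator s br f"
  shows "dhat V br f \<in> cochains2_even s V
    \<and> (\<forall>a b. at_minus_D_lam s (dhat V br f) a b = bracket_N s br f a b)
    \<and> generates_deformation s V br (dhat V br f)
    \<and> trivial_deformation s V br (dhat V br f)"
proof -
  interpret nijenhuis s V br f
    using assms by (intro nijenhuis.intro even_cochain.intro even_cochain_axioms.intro
      nijenhuis_axioms.intro)
  show ?thesis
    by (simp add: dhat_cochain at_minus_D_lam_dhat trivial_deformation_dhat
      generates_deformation_def deformed_bracket_dhat lie_conformal_superalgebra_dbr)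
qed

end
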